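(* Fix $l>0$, let $\sigma_d=l/d$, let $f^\ast=\lim_{x\downarrow0}\frac{f(x)+f(1-x)}{2}$, $a(l)=\exp(-f^\ast l/2)$ and $\phi(l)=\frac{l^2}{3}\exp(-f^\ast l/2)$. With $\mathbf{X}_0^d\sim\pi_d$, $$\mathbb{E}_{\pi_d}\left[J_d(\mathbf{X}_0^d)\right]\to a(l)\qquad\text{as } d\to\infty.$$ Moreover, $\phi(l)$ (as a function of $l>0$) is maximized by $l=\hat l=4/f^\ast$, and $$a(\hat l)=\exp(-2)\ (=0.1353\text{ to four decimal places}).$$
   Context: Let $g:[0,1]\to\mathbb{R}$ be twice differentiable on $[0,1]$ with $\sup_{0\le y\le1}|g'(y)|<\infty$. Let $f$ be the probability density on $\mathbb{R}$ with $f(x)\propto\exp(g(x))1_{\{0<x<1\}}$, and $\pi_d(\mathbf{x}^d)=\prod_{i=1}^d f(x_i)$. $J_d(\mathbf{x}^d)$ is the probability that the random walk Metropolis algorithm with target $\pi_d$ accepts a proposed move from $\mathbf{x}^d$: $$J_d(\mathbf{x}^d)=\mathbb{E}\left[1\wedge\frac{\pi_d(\mathbf{x}^d+\sigma_d\mathbf{Z}^d)}{\pi_d(\mathbf{x}^d)}\right],$$ where $\mathbf{Z}^d$ has i.i.d. components uniform on $[-1,1]$. *)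

theory Defs
  imports "HOL-Probability.Probability"
begin

(* Only the values of g on the open unit interval matter below: a function g on [0,1] is
   represented by an arbitrary extension to the whole line. *)

definition unnormalised_density :: "(real \<Rightarrow> real) \<Rightarrow> real \<Rightarrow> real" where
  "unnormalised_density g x = exp (g x) * indicator {0<..<1} x"

definition marginal_density :: "(real \<Rightarrow> real) \<Rightarrow> real \<Rightarrow> real" where
  "marginal_density g x =
     unnormalised_density g x / (\<integral>y. unnormalised_density g y \<partial>lborel)"

(* Points of R^d are functions on nat of which only the coordinates i < d are relevant. *)

definition target_density :: "(real \<Rightarrow> real) \<Rightarrow> nat \<Rightarrow> (nat \<Rightarrow> real) \<Rightarrow> real" where
  "target_density g d x = (\<Prod>i<d. marginal_density g (x i))"

definition target_measure :: "(real \<Rightarrow> real) \<Rightarrow> nat \<Rightarrow> (nat \<Rightarrow> real) measure" where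
  "target_measure g d =
     density (\<Pi>\<^sub>M i\<in>{..<d}. lborel) (\<lambda>x. ennreal (target_density g d x))"

(* The law of the vector with i.i.d. components uniform on [-1,1]. *)

definition increment_measure :: "nat \<Rightarrow> (nat \<Rightarrow> real) measure" where
  "increment_measure d = (\<Pi>\<^sub>M i\<in>{..<d}. uniform_measure lborel {-1..1})"

(* At points x where the target density vanishes the quotient is 0 by the convention for
   division by zero; these points form a null set of target_measure. *)

definition acceptance_prob ::
    "(real \<Rightarrow> real) \<Rightarrow> nat \<Rightarrow> real \<Rightarrow> (nat \<Rightarrow> real) \<Rightarrow> real" where
  "acceptance_prob g d \<sigma> x =
     (\<integral>z. min 1 (target_density g d (\<lambda>i. x i + \<sigma> * z i) / target_density g d x)
        \<partial>increment_measure d)"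

definition fstar :: "(real \<Rightarrow> real) \<Rightarrow> real" where
  "fstar g = Lim (at_right 0) (\<lambda>x. (marginal_density g x + marginal_density g (1 - x)) / 2)"

definition limit_acceptance :: "(real \<Rightarrow> real) \<Rightarrow> real \<Rightarrow> real" where
  "limit_acceptance g l = exp (- (fstar g * l / 2))"

definition speed :: "(real \<Rightarrow> real) \<Rightarrow> real \<Rightarrow> real" where
  "speed g l = l\<^sup>2 / 3 * exp (- (fstar g * l / 2))"

end

theory Submission
  imports Defs
begin

text \<open>
  With \<open>f = r\<^sup>2\<close> the marginal density, the mean acceptance probability is the integral of
  \<open>min a b\<close>, where \<open>a = \<pi>(x)\<close> and \<open>b = \<pi>(x + \<sigma>z)\<close>.
  It is compared with integrals of products over the coordinates: \<open>min a b \<le> sqrt (a * b)\<close>, and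
  \<open>(t\<^sup>2 - 1) * min a b \<ge> 2 * t * sqrt (a * b) - a - b\<close> for \<open>t > 1\<close> wherever both points lie in
  the cube. Hence the mean acceptance probability is at most \<open>q ^ d\<close> and at least
  \<open>(2 * t * q ^ d - 2 * p ^ d) / (t\<^sup>2 - 1)\<close>, where \<open>p\<close> is the probability that one coordinate stays
  in the unit interval and \<open>q\<close> is the integral of \<open>r(x) r(x + \<sigma>z)\<close>. Since \<open>2 * (p - q)\<close> is an
  integral of \<open>(r(x) - r(x + \<sigma>z))\<^sup>2\<close> and \<open>r\<close> is Lipschitz inside the interval, \<open>p\<close> and \<open>q\<close> are both
  \<open>1 - f\<^sup>* l / (2 * d)\<close> up to \<open>O(1 / d\<^sup>2)\<close>, so \<open>p ^ d\<close> and \<open>q ^ d\<close> have the same limit \<open>a(l)\<close>.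
  Finally let \<open>t\<close> tend to \<open>1\<close>.
\<close>

section \<open>The uniform law on \<open>[-1,1]\<close>, Fubini, and integrals of products\<close>

abbreviation unif :: "real measure" where
  "unif \<equiv> uniform_measure lborel {-1..1}"

lemma prob_space_unif: "prob_space unif"
  by (rule prob_space_uniform_measure) auto

lemma integral_unif:
  fixes f :: "real \<Rightarrow> real"
  assumes [measurable]: "f \<in> borel_measurable borel"
  shows "integral\<^sup>L unif f = (\<integral>z. f z * indicator {-1..1} z \<partial>lborel) / 2"
proof -
  have "indicator {-1..1} z / emeasure lborel {-1..1::real} = ennreal (indicator {-1..1} z / 2)" for z :: real
    by (simp add: indicator_def divide_ennreal flip: ennreal_numeral ennreal_1)
  then have "integral\<^sup>L unif f = integral\<^sup>L (density lborel (\<lambda>z. ennreal (indicator {-1..1} z / 2))) f"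
    by (simp only: uniform_measure_def)
  also have "\<dots> = (\<integral>z. (indicator {-1..1} z / 2) *\<^sub>R f z \<partial>lborel)"
    by (rule integral_density) auto
  finally show ?thesis
    by (simp add: mult.commute)
qed

lemma AE_unif_abs_le: "AE z in unif. \<bar>z\<bar> \<le> 1"
  by (rule AE_uniform_measureI) auto

lemma integral_unif_reflect:
  fixes f :: "real \<Rightarrow> real"
  assumes [measurable]: "f \<in> borel_measurable borel"
  shows "(\<integral>z. f (- z) \<partial>unif) = integral\<^sup>L unif f"
proof -
  have "(\<integral>z. f z * indicator {-1..1} z \<partial>lborel) = (\<integral>z. f (-z) * indicator {-1..1} (-z) \<partial>lborel)"
    using lborel_integral_real_affine[of "-1" "\<lambda>z. f z * indicator {-1..1} z" 0] by simp
  also have "\<dots> = (\<integral>z. f (-z) * indicator {-1..1} z \<partial>lborel)"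
    by (rule Bochner_Integration.integral_cong) (auto split: split_indicator)
  finally show ?thesis
    by (simp add: integral_unif)
qed

lemma integral_unif_abs: "(\<integral>z. \<bar>z\<bar> \<partial>unif) = 1/2"
proof -
  have int: "integrable lborel (\<lambda>z::real. z ^ 1 * indicator {a..b} z)" for a b
    by (rule borel_integrable_atLeastAtMost) auto
  have "(\<integral>z. \<bar>z\<bar> * indicator {-1..1::real} z \<partial>lborel)
      = (\<integral>z. z ^ 1 * indicator {0..1} z - z ^ 1 * indicator {-1..0} z \<partial>lborel)"
    by (rule Bochner_Integration.integral_cong) (auto simp: indicator_def)
  also have "\<dots> = (\<integral>z. z ^ 1 * indicator {0..1} z \<partial>lborel) - (\<integral>z. z ^ 1 * indicator {-1..0::real} z \<partial>lborel)"
    by (rule Bochner_Integration.integral_diff[OF int int])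
  also have "\<dots> = 1"
    by (subst (1 2) integral_power) auto
  finally show ?thesis
    by (simp add: integral_unif)
qed

lemma abs_integral_unif_le:
  assumes "integrable unif u" and "\<And>z. \<bar>z\<bar> \<le> 1 \<Longrightarrow> \<bar>u z\<bar> \<le> K"
  shows "\<bar>integral\<^sup>L unif u\<bar> \<le> (K :: real)"
proof -
  interpret U: prob_space unif
    by (rule prob_space_unif)
  have K: "AE z in unif. \<bar>u z\<bar> \<le> K"
    using AE_unif_abs_le by eventually_elim (rule assms)
  then have "integral\<^sup>L unif u \<le> K" "- K \<le> integral\<^sup>L unif u"
    by (auto intro!: U.integral_le_const U.integral_ge_const assms)
  then show ?thesis
    by simp
qed

text \<open>Serves to evaluate the mass of a thin boundary layer \<open>A\<close>: there
  \<open>u\<close> is nearly constant, so the error is at most its oscillation times the length of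
  \<open>A\<close>.\<close>

lemma abs_integral_indicator_minus_le:
  fixes u :: "real \<Rightarrow> real"
  assumes int: "integrable M (\<lambda>x. u x * indicator A x)"
    and A: "A \<in> sets M" "emeasure M A < \<infinity>"
    and bound: "\<And>x. x \<in> A \<Longrightarrow> \<bar>u x - c\<bar> \<le> e"
  shows "\<bar>(\<integral>x. u x * indicator A x \<partial>M) - c * measure M A\<bar> \<le> e * measure M A"
proof -
  have int': "integrable M (\<lambda>x. k * indicator A x)" for k :: real
    using A by (intro integrable_mult_right integrable_real_indicator)
  have val: "(\<integral>x. k * indicator A x \<partial>M) = k * measure M A" for k :: real
    using A sets.Int_space_eq2[of A M] by simp
  have "\<bar>\<integral>x. u x * indicator A x - c * indicator A x \<partial>M\<bar> \<le> (\<integral>x. e * indicator A x \<partial>M)"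
    using bound int int'
    by (intro integral_abs_bound_integral Bochner_Integration.integrable_diff) (auto split: split_indicator)
  then show ?thesis
    by (simp only: Bochner_Integration.integral_diff[OF int int'] val)
qed

text \<open>The dominating function depends on \<open>x\<close> alone and is integrable over the
  product, because \<open>unif\<close> has mass 1 and the unit interval has finite length. This
  justifies Fubini for the kernels of a single coordinate.\<close>

lemma
  fixes k :: "real \<Rightarrow> real \<Rightarrow> real"
  assumes k [measurable]: "case_prod k \<in> borel_measurable (borel \<Otimes>\<^sub>M borel)"
    and bound: "\<And>x z. \<bar>k x z\<bar> \<le> B * indicator {0<..<1} x"
  shows unif_integrable: "integrable unif (k x)"
    and lborel_integrable_unif: "integrable lborel (\<lambda>x. \<integral>z. k x z \<partial>unif)"
    and unif_integrable_lborel: "integrable unif (\<lambda>z. \<integral>x. k x z \<partial>lborel)"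
    and unif_Fubini: "(\<integral>x. \<integral>z. k x z \<partial>unif \<partial>lborel) = (\<integral>z. \<integral>x. k x z \<partial>lborel \<partial>unif)"
proof -
  interpret U: prob_space unif
    by (rule prob_space_unif)
  interpret pair_sigma_finite lborel unif
    by unfold_locales
  show "integrable unif (k x)"
    by (rule U.integrable_const_bound[of _ "B * indicator {0<..<1} x"]) (use bound in auto)
  have dom: "integrable (lborel \<Otimes>\<^sub>M unif) (\<lambda>(x, z). B * indicator {0<..<1::real} x)"
    by (intro Fubini_integrable) (auto simp: split_beta U.prob_space)
  have int: "integrable (lborel \<Otimes>\<^sub>M unif) (case_prod k)"
    by (rule Bochner_Integration.integrable_bound[OF dom])
      (use bound in \<open>auto intro!: AE_I2 intro: order_trans[OF _ abs_ge_self]\<close>)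
  show "integrable lborel (\<lambda>x. \<integral>z. k x z \<partial>unif)"
    using integrable_fst[OF int] .
  show "integrable unif (\<lambda>z. \<integral>x. k x z \<partial>lborel)"
    using integrable_snd[OF int] .
  show "(\<integral>x. \<integral>z. k x z \<partial>unif \<partial>lborel) = (\<integral>z. \<integral>x. k x z \<partial>lborel \<partial>unif)"
    using Fubini_integral[OF int] by simp
qed

text \<open>The integrand factorises over the coordinates, first in \<open>z\<close> for fixed
  \<open>x\<close> and then in \<open>x\<close>. This is how \<open>d\<close>-dimensional integrals
  become \<open>d\<close>-th powers of one-coordinate quantities.\<close>

lemma prod_integral_iterated:
  fixes k :: "real \<Rightarrow> real \<Rightarrow> real" and d :: nat
  assumes k: "case_prod k \<in> borel_measurable (borel \<Otimes>\<^sub>M borel)"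
    and bound: "\<And>x z. \<bar>k x z\<bar> \<le> B * indicator {0<..<1} x"
  defines "J \<equiv> \<lambda>x. \<integral>z. (\<Prod>i<d. k (x i) (z i)) \<partial>(\<Pi>\<^sub>M i\<in>{..<d}. unif)"
  shows "(\<integral>x. J x \<partial>(\<Pi>\<^sub>M i\<in>{..<d}. lborel)) = (\<integral>x. \<integral>z. k x z \<partial>unif \<partial>lborel) ^ d"
    and "integrable (\<Pi>\<^sub>M i\<in>{..<d}. lborel) J"
    and "integrable (\<Pi>\<^sub>M i\<in>{..<d}. unif) (\<lambda>z. \<Prod>i<d. k (x i) (z i))"
proof -
  interpret U: prob_space unif
    by (rule prob_space_unif)
  interpret U: product_sigma_finite "\<lambda>i::nat. unif"
    by unfold_locales
  interpret R: product_sigma_finite "\<lambda>i::nat. lborel :: real measure"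
    by unfold_locales
  have J: "J = (\<lambda>x. \<Prod>i<d. \<integral>z. k (x i) z \<partial>unif)"
    unfolding J_def
    by (intro ext U.product_integral_prod finite_lessThan unif_integrable[OF k bound])
  show "(\<integral>x. J x \<partial>(\<Pi>\<^sub>M i\<in>{..<d}. lborel)) = (\<integral>x. \<integral>z. k x z \<partial>unif \<partial>lborel) ^ d"
    unfolding J
    by (subst R.product_integral_prod) (auto intro!: lborel_integrable_unif[OF k bound])
  show "integrable (\<Pi>\<^sub>M i\<in>{..<d}. lborel) J"
    unfolding J
    by (intro R.product_integrable_prod finite_lessThan lborel_integrable_unif[OF k bound])
  show "integrable (\<Pi>\<^sub>M i\<in>{..<d}. unif) (\<lambda>z. \<Prod>i<d. k (x i) (z i))"
    by (intro U.product_integrable_prod finite_lessThan unif_integrable[OF k bound])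
qed

section \<open>Elementary inequalities and limits\<close>

lemma power_tendsto_exp:
  fixes a :: "nat \<Rightarrow> real"
  assumes "eventually (\<lambda>n. \<bar>a n - (1 - c / real n)\<bar> \<le> K / (real n)\<^sup>2) sequentially"
    and "eventually (\<lambda>n. \<bar>a n\<bar> \<le> 1) sequentially" and "0 \<le> c"
  shows "(\<lambda>n. a n ^ n) \<longlonglongrightarrow> exp (- c)"
proof -
  have "eventually (\<lambda>n. norm (a n ^ n - (1 + (- c) / real n) ^ n) \<le> K / real n) sequentially"
    \<comment> \<open>From this index on \<open>c / n\<close> lies in \<open>[0,1]\<close>, so the
      comparison base \<open>1 - c / n\<close> does too.\<close>
    using assms(1,2) eventually_ge_at_top[of "nat \<lceil>c\<rceil> + 1"]
  proof eventually_elim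
    case (elim n)
    then have n: "c \<le> real n" "0 < real n"
      by linarith+
    then have "0 \<le> c / real n" "c / real n \<le> 1"
      using \<open>0 \<le> c\<close> by auto
    \<comment> \<open>For bases of modulus at most 1 the \<open>n\<close>-th power is Lipschitz with
      constant \<open>n\<close>, so an error of order \<open>1 / n^2\<close> in the base costs only
      order \<open>1 / n\<close> in the power.\<close>
    then have "norm (a n ^ n - (1 + (- c) / real n) ^ n) \<le> real n * norm (a n - (1 + (- c) / real n))"
      using elim by (intro norm_power_diff) auto
    also have "\<dots> \<le> real n * (K / (real n)\<^sup>2)"
      using elim by (intro mult_left_mono) auto
    also have "\<dots> = K / real n"
      using n by (simp add: power2_eq_square)
    finally show ?case .
  qed
  moreover have "(\<lambda>n. K / real n) \<longlonglongrightarrow> 0"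
    by (rule lim_const_over_n)
  ultimately have "(\<lambda>n. a n ^ n - (1 + (- c) / real n) ^ n) \<longlonglongrightarrow> 0"
    by (rule Lim_null_comparison)
  from tendsto_add[OF this tendsto_exp_limit_sequentially[of "- c"]] show ?thesis
    by simp
qed

text \<open>For \<open>a = u\<^sup>2\<close>, \<open>b = v\<^sup>2\<close> this is \<open>0 \<le> (t * min u v - max u v)\<^sup>2\<close>; the indicators \<open>I\<close>, \<open>J\<close>
  account for the points where exactly one of the densities vanishes by leaving the support.\<close>

lemma min_sq_lower_bound:
  fixes u v :: real
  assumes "0 \<le> u" "0 \<le> v" "1 < t" and I: "I = 0 \<and> u = 0 \<or> I = 1" and J: "J = 0 \<and> v = 0 \<or> J = 1"
  shows "2 * t * (u * v) - u\<^sup>2 * J - I * v\<^sup>2 \<le> (t\<^sup>2 - 1) * min (u\<^sup>2) (v\<^sup>2)"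
proof (cases "I = 0 \<or> J = 0")
  case True
  then show ?thesis
    using assms by auto
next
  case False
  then have [simp]: "I = 1" "J = 1"
    using I J by auto
  show ?thesis
  proof (cases "u \<le> v")
    case True
    then have "min (u\<^sup>2) (v\<^sup>2) = u\<^sup>2"
      using \<open>0 \<le> u\<close> by (simp add: power_mono)
    then show ?thesis
      using zero_le_power2[of "t * u - v"] by (simp add: power2_eq_square algebra_simps)
  next
    case False
    then have "min (u\<^sup>2) (v\<^sup>2) = v\<^sup>2"
      using \<open>0 \<le> v\<close> by (simp add: power_mono min_absorb2)
    then show ?thesis
      using zero_le_power2[of "t * v - u"] by (simp add: power2_eq_square algebra_simps)
  qed
qed

lemma min_sq_le_mult:
  fixes u v :: real
  assumes "0 \<le> u" "0 \<le> v"
  shows "min (u\<^sup>2) (v\<^sup>2) \<le> u * v"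
  using assms mult_left_mono[of u v u] mult_right_mono[of v u v]
  by (cases "u \<le> v") (auto simp: power2_eq_square min_le_iff_disj)

text \<open>For fixed \<open>t\<close> the lower bound on \<open>m n\<close> tends to
  \<open>2 * a * (t - 1) / (t^2 - 1) = 2 * a / (t + 1)\<close>, which approaches \<open>a\<close> as
  \<open>t\<close> decreases to 1. So \<open>t\<close> is chosen first, depending on
  \<open>y\<close>, and only then \<open>n\<close> is taken large.\<close>

lemma tendsto_of_parametric_sandwich:
  fixes m p q :: "nat \<Rightarrow> real"
  assumes p: "p \<longlonglongrightarrow> a" and q: "q \<longlonglongrightarrow> a"
    and upper: "eventually (\<lambda>n. m n \<le> q n) sequentially"
    and lower: "eventually (\<lambda>n. \<forall>t>1. 2 * t * q n - 2 * p n \<le> (t\<^sup>2 - 1) * m n) sequentially"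
  shows "m \<longlonglongrightarrow> a"
proof (rule order_tendstoI)
  fix y
  assume "y < a"
  have "((\<lambda>t. 2 * a / (t + 1)) \<longlongrightarrow> 2 * a / (1 + 1)) (at_right 1)"
    by (intro tendsto_intros) auto
  then have "eventually (\<lambda>t. y < 2 * a / (t + 1)) (at_right 1)"
    using \<open>y < a\<close> by (intro order_tendstoD(1)) auto
  then have "eventually (\<lambda>t. 1 < t \<and> y < 2 * a / (t + 1)) (at_right 1)"
    using eventually_at_right_less[of "1::real"] by eventually_elim auto
  then obtain t where t: "1 < t" "y < 2 * a / (t + 1)"
    using eventually_happens[of _ "at_right (1::real)"] by auto
  have t2: "0 < t\<^sup>2 - 1"
    using t by (simp add: power_strict_increasing_iff[of t 0 2, simplified])
  have "(\<lambda>n. (2 * t * q n - 2 * p n) / (t\<^sup>2 - 1)) \<longlonglongrightarrow> (2 * t * a - 2 * a) / (t\<^sup>2 - 1)"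
    using t2 by (intro tendsto_intros p q) auto
  moreover have "2 * t * a - 2 * a = 2 * a * (t - 1)" "t\<^sup>2 - 1 = (t + 1) * (t - 1)"
    by (simp_all add: algebra_simps power2_eq_square)
  ultimately have "(\<lambda>n. (2 * t * q n - 2 * p n) / (t\<^sup>2 - 1)) \<longlonglongrightarrow> 2 * a / (t + 1)"
    using t by simp
  then have "eventually (\<lambda>n. y < (2 * t * q n - 2 * p n) / (t\<^sup>2 - 1)) sequentially"
    using t by (intro order_tendstoD(1)) auto
  then show "eventually (\<lambda>n. y < m n) sequentially"
    using lower
  proof eventually_elim
    case (elim n)
    then have "(2 * t * q n - 2 * p n) / (t\<^sup>2 - 1) \<le> m n"
      using t t2 by (simp add: pos_divide_le_eq mult.commute)
    then show ?case
      using elim by simp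
  qed
next
  fix y
  assume "a < y"
  then have "eventually (\<lambda>n. q n < y) sequentially"
    by (rule order_tendstoD(2)[OF q])
  then show "eventually (\<lambda>n. m n < y) sequentially"
    using upper by eventually_elim simp
qed

subsection \<open>One coordinate\<close>

text \<open>\<open>h\<close> is the square root of the marginal density, continued to the endpoints
  instead of being cut off there. Thus \<open>h 0\<close> and \<open>h 1\<close> carry the boundary
  values of the density, while \<open>r\<close> below vanishes at both endpoints and jumps there
  when these values are positive.\<close>

locale root_density =
  fixes h :: "real \<Rightarrow> real" and L :: real
  assumes lipschitz: "x \<in> {0..1} \<Longrightarrow> y \<in> {0..1} \<Longrightarrow> \<bar>h x - h y\<bar> \<le> L * \<bar>x - y\<bar>"
    and nonneg: "x \<in> {0..1} \<Longrightarrow> 0 \<le> h x"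
    and total: "(\<integral>x. (h x * indicator {0<..<1} x)\<^sup>2 \<partial>lborel) = 1"
begin

abbreviation I :: "real \<Rightarrow> real" where
  "I \<equiv> indicator {0<..<1}"

definition r :: "real \<Rightarrow> real" where
  "r x = h x * I x"

text \<open>An upper bound for \<open>h\<close> on the unit interval, from the Lipschitz condition
  at 0.\<close>

definition H :: real where
  "H = h 0 + L"

lemma L_nonneg: "0 \<le> L"
  using lipschitz[of 0 1] by simp

lemma r_measurable [measurable]: "r \<in> borel_measurable borel"
proof -
  have "L-lipschitz_on {0..1} h"
    using lipschitz L_nonneg by (intro lipschitz_onI) (auto simp: dist_real_def)
  then have "continuous_on {0<..<1} h"
    by (meson lipschitz_on_continuous_on continuous_on_subset greaterThanLessThan_subseteq_atLeastAtMost_iff order_refl)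
  then have "(\<lambda>x. I x *\<^sub>R h x) \<in> borel_measurable borel"
    by (intro borel_measurable_continuous_on_indicator) auto
  then show ?thesis
    by (simp add: r_def[abs_def] mult.commute)
qed

lemma h_le: "h x \<le> H" if "x \<in> {0..1}"
proof -
  have "L * x \<le> L * 1"
    using that L_nonneg by (intro mult_left_mono) auto
  then show ?thesis
    using lipschitz[of x 0] that by (auto simp: H_def)
qed

lemma H_nonneg: "0 \<le> H"
  using h_le[of 0] nonneg[of 0] by simp

lemma r_nonneg: "0 \<le> r x"
  using nonneg[of x] by (auto simp: r_def split: split_indicator)

lemma r_le: "r x \<le> H * I x"
  using h_le[of x] by (auto simp: r_def split: split_indicator)

lemma r_le': "r x \<le> H"
  using r_le[of x] H_nonneg by (auto split: split_indicator_asm)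

lemma r_sq_le: "(r x)\<^sup>2 \<le> H\<^sup>2 * I x"
  using power_mono[OF r_le r_nonneg, of x 2] by (auto simp: power_mult_distrib split: split_indicator)

lemma integrable_of_bounded:
  assumes [measurable]: "u \<in> borel_measurable borel" and "\<And>x. \<bar>u x\<bar> \<le> B * I x"
  shows "integrable lborel u"
proof (rule Bochner_Integration.integrable_bound)
  show "integrable lborel (\<lambda>x. B * I x)"
    by (intro integrable_mult_right integrable_real_indicator) auto
  show "AE x in lborel. norm (u x) \<le> norm (B * I x)"
    using assms(2) by (auto intro: order_trans[OF _ abs_ge_self])
qed simp

lemma integrable_r_sq_times:
  assumes [measurable]: "u \<in> borel_measurable borel" and u: "\<And>x. 0 \<le> u x" "\<And>x. u x \<le> 1"
  shows "integrable lborel (\<lambda>x. (r x)\<^sup>2 * u x)"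
proof (rule integrable_of_bounded[of _ "H\<^sup>2"])
  show "\<bar>(r x)\<^sup>2 * u x\<bar> \<le> H\<^sup>2 * I x" for x
    using mult_mono[OF r_sq_le[of x] u(2)[of x]] u(1)[of x] by simp
qed simp

lemma integrable_r_sq: "integrable lborel (\<lambda>x. (r x)\<^sup>2)"
  using integrable_r_sq_times[of "\<lambda>_. 1"] by simp

lemma integral_r_sq: "(\<integral>x. (r x)\<^sup>2 \<partial>lborel) = 1"
  using total by (simp add: r_def)

lemma h_sq_lipschitz:
  assumes "x \<in> {0..1}" "y \<in> {0..1}"
  shows "\<bar>(h x)\<^sup>2 - (h y)\<^sup>2\<bar> \<le> 2 * L * H * \<bar>x - y\<bar>"
proof -
  have "\<bar>(h x)\<^sup>2 - (h y)\<^sup>2\<bar> = \<bar>h x - h y\<bar> * (h x + h y)"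
    using nonneg assms by (simp add: power2_eq_square square_diff_square_factored abs_mult)
  also have "\<dots> \<le> (L * \<bar>x - y\<bar>) * (2 * H)"
    using assms L_nonneg h_le[of x] h_le[of y] nonneg[of x] nonneg[of y]
    by (intro mult_mono lipschitz) auto
  finally show ?thesis
    by (simp add: mult_ac)
qed

text \<open>The probability that a point with density \<open>r\<^sup>2\<close> is still in the open
  unit interval after a shift by \<open>s\<close>.\<close>

definition stay :: "real \<Rightarrow> real" where
  "stay s = (\<integral>x. (r x)\<^sup>2 * I (x + s) \<partial>lborel)"

text \<open>The Bhattacharyya coefficient (Hellinger affinity) of the density
  \<open>r\<^sup>2\<close> and its translate.\<close>

definition affinity :: "real \<Rightarrow> real" where
  "affinity s = (\<integral>x. r x * r (x + s) \<partial>lborel)"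

lemma stay_translate: "(\<integral>x. I x * (r (x + s))\<^sup>2 \<partial>lborel) = stay (- s)"
  using lborel_integral_real_affine[of 1 "\<lambda>x. I x * (r (x + s))\<^sup>2" "-s"]
  by (simp add: stay_def mult.commute)

text \<open>A shift to the right loses the mass of the layer \<open>{1-s..<1}\<close>, a shift to
  the left that of \<open>{0<..s}\<close>. Both have length \<open>s\<close>, and on them the
  density differs from \<open>(h 1)\<^sup>2\<close> and \<open>(h 0)\<^sup>2\<close> by at most
  \<open>2 * L * H * s\<close>; the two errors add up to the bound.\<close>

lemma stay_pair_expansion_nonneg:
  assumes "0 \<le> s" "s < 1"
  shows "\<bar>stay s + stay (- s) - (2 - ((h 0)\<^sup>2 + (h 1)\<^sup>2) * s)\<bar> \<le> 4 * L * H * s\<^sup>2"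
proof -
  have LH: "0 \<le> 2 * L * H"
    using L_nonneg H_nonneg by simp
  have int: "integrable lborel (\<lambda>x. (r x)\<^sup>2 * indicator A x)" if [measurable]: "A \<in> sets borel" for A
    by (rule integrable_r_sq_times) (auto split: split_indicator)
  have "stay s = (\<integral>x. (r x)\<^sup>2 - (r x)\<^sup>2 * indicator {1-s..<1} x \<partial>lborel)"
    unfolding stay_def
    by (rule Bochner_Integration.integral_cong) (use assms in \<open>auto simp: r_def split: split_indicator\<close>)
  also have "\<dots> = 1 - (\<integral>x. (r x)\<^sup>2 * indicator {1-s..<1} x \<partial>lborel)"
    by (simp add: integrable_r_sq int integral_r_sq)
  finally have 1: "stay s = 1 - (\<integral>x. (r x)\<^sup>2 * indicator {1-s..<1} x \<partial>lborel)" .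
  have "stay (-s) = (\<integral>x. (r x)\<^sup>2 - (r x)\<^sup>2 * indicator {0<..s} x \<partial>lborel)"
    unfolding stay_def
    by (rule Bochner_Integration.integral_cong) (use assms in \<open>auto simp: r_def split: split_indicator\<close>)
  also have "\<dots> = 1 - (\<integral>x. (r x)\<^sup>2 * indicator {0<..s} x \<partial>lborel)"
    by (simp add: integrable_r_sq int integral_r_sq)
  finally have 2: "stay (- s) = 1 - (\<integral>x. (r x)\<^sup>2 * indicator {0<..s} x \<partial>lborel)" .
  have bound: "\<bar>(r x)\<^sup>2 - (h y)\<^sup>2\<bar> \<le> 2 * L * H * s"
    if "0 < x" "x < 1" "y \<in> {0..1}" "\<bar>x - y\<bar> \<le> s" for x y
    using h_sq_lipschitz[of x y] mult_left_mono[OF that(4) LH] that(1-3) by (simp add: r_def)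
  have 3: "\<bar>(\<integral>x. (r x)\<^sup>2 * indicator {0<..s} x \<partial>lborel) - (h 0)\<^sup>2 * measure lborel {0<..s}\<bar>
      \<le> 2 * L * H * s * measure lborel {0<..s}"
    by (rule abs_integral_indicator_minus_le) (use assms bound int in auto)
  have 4: "\<bar>(\<integral>x. (r x)\<^sup>2 * indicator {1-s..<1} x \<partial>lborel) - (h 1)\<^sup>2 * measure lborel {1-s..<1}\<bar>
      \<le> 2 * L * H * s * measure lborel {1-s..<1}"
    by (rule abs_integral_indicator_minus_le) (use assms bound int in auto)
  show ?thesis
    using 3 4 assms unfolding 1 2 by (simp add: algebra_simps power2_eq_square)
qed

lemma stay_pair_expansion:
  assumes "\<bar>s\<bar> < 1"
  shows "\<bar>stay s + stay (- s) - (2 - ((h 0)\<^sup>2 + (h 1)\<^sup>2) * \<bar>s\<bar>)\<bar> \<le> 4 * L * H * s\<^sup>2"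
  using stay_pair_expansion_nonneg[of s] stay_pair_expansion_nonneg[of "-s"] assms
  by (cases "0 \<le> s") (auto simp: add.commute)

text \<open>The identity $a^2 + b^2 - 2ab = (a-b)^2$ makes the defect quadratic in the shift.\<close>

lemma affinity_defect:
  shows affinity_defect_nonneg: "2 * affinity s \<le> stay s + stay (- s)"
    and affinity_defect_le: "stay s + stay (- s) - 2 * affinity s \<le> L\<^sup>2 * s\<^sup>2"
proof -
  have 1: "integrable lborel (\<lambda>x. (r x)\<^sup>2 * I (x + s))"
    by (rule integrable_r_sq_times) (auto split: split_indicator)
  have 2: "integrable lborel (\<lambda>x. I x * (r (x + s))\<^sup>2)"
    by (rule integrable_of_bounded[of _ "H\<^sup>2"])
      (use r_sq_le power_mono[OF r_le' r_nonneg, of _ 2] in \<open>auto split: split_indicator\<close>)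
  have 3: "integrable lborel (\<lambda>x. r x * r (x + s))"
  proof (rule integrable_of_bounded[of _ "H * H"])
    show "\<bar>r x * r (x + s)\<bar> \<le> H * H * I x" for x
      using mult_mono[OF r_le[of x] r_le'[of "x+s"]] r_nonneg H_nonneg by (simp add: mult_ac)
  qed simp
  \<comment> \<open>The indicators make all three terms vanish unless both \<open>x\<close> and
    \<open>x + s\<close> lie inside. The jumps of \<open>r\<close> at the endpoints therefore do not
    enter, and the Lipschitz bound for \<open>h\<close> applies wherever \<open>?d\<close> is
    nonzero.\<close>
  let ?d = "\<lambda>x. (r x)\<^sup>2 * I (x + s) + I x * (r (x + s))\<^sup>2 - 2 * (r x * r (x + s))"
  have bounds: "0 \<le> ?d x \<and> ?d x \<le> (L\<^sup>2 * s\<^sup>2) * I x" for x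
  proof (cases "x \<in> {0<..<1} \<and> x + s \<in> {0<..<1}")
    case True
    then have "?d x = (h x - h (x + s))\<^sup>2"
      by (simp add: r_def power2_eq_square algebra_simps)
    moreover have "\<bar>h x - h (x + s)\<bar>\<^sup>2 \<le> (L * \<bar>s\<bar>)\<^sup>2"
      using lipschitz[of x "x + s"] True by (intro power_mono) auto
    ultimately show ?thesis
      using True by (simp add: power_mult_distrib)
  qed (auto simp: r_def split: split_indicator)
  have int: "integrable lborel ?d"
    using 1 2 3 by simp
  have val: "integral\<^sup>L lborel ?d = stay s + stay (- s) - 2 * affinity s"
    using 1 2 3 by (simp add: stay_def[of s] affinity_def flip: stay_translate)
  have "0 \<le> integral\<^sup>L lborel ?d"
    using bounds by (intro integral_nonneg_AE AE_I2) auto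
  then show "2 * affinity s \<le> stay s + stay (- s)"
    by (simp add: val)
  have "integrable lborel (\<lambda>x. (L\<^sup>2 * s\<^sup>2) * I x)"
    by (intro integrable_mult_right integrable_real_indicator) auto
  then have "integral\<^sup>L lborel ?d \<le> (\<integral>x. (L\<^sup>2 * s\<^sup>2) * I x \<partial>lborel)"
    using bounds int by (intro integral_mono) auto
  then show "stay s + stay (- s) - 2 * affinity s \<le> L\<^sup>2 * s\<^sup>2"
    by (simp add: val)
qed

lemma stay_nonneg: "0 \<le> stay s"
  unfolding stay_def by (intro integral_nonneg_AE AE_I2) auto

lemma stay_le_1: "stay s \<le> 1"
proof -
  have "stay s \<le> (\<integral>x. (r x)\<^sup>2 \<partial>lborel)"
    unfolding stay_def
    by (intro integral_mono integrable_r_sq integrable_r_sq_times) (auto split: split_indicator)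
  then show ?thesis
    by (simp add: integral_r_sq)
qed

lemma affinity_nonneg: "0 \<le> affinity s"
  unfolding affinity_def by (intro integral_nonneg_AE AE_I2) (auto simp: r_nonneg)

lemma affinity_le_1: "affinity s \<le> 1"
  using affinity_defect_nonneg[of s] stay_le_1[of s] stay_le_1[of "- s"] by simp

text \<open>This and \<open>mean_affinity\<close> are the \<open>p\<close> and \<open>q\<close> of
  the overview.\<close>

definition mean_stay :: "real \<Rightarrow> real" where
  "mean_stay \<sigma> = (\<integral>x. \<integral>z. (r x)\<^sup>2 * I (x + \<sigma> * z) \<partial>unif \<partial>lborel)"

definition mean_affinity :: "real \<Rightarrow> real" where
  "mean_affinity \<sigma> = (\<integral>x. \<integral>z. r x * r (x + \<sigma> * z) \<partial>unif \<partial>lborel)"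

lemma stay_kernel:
  "(\<lambda>(x, z). (r x)\<^sup>2 * I (x + \<sigma> * z)) \<in> borel_measurable (borel \<Otimes>\<^sub>M borel)"
  "\<bar>(r x)\<^sup>2 * I (x + \<sigma> * z)\<bar> \<le> H\<^sup>2 * I x"
  using r_sq_le[of x] zero_le_power2[of "r x"] by (measurable, auto split: split_indicator)

lemma reverse_stay_kernel:
  "(\<lambda>(x, z). I x * (r (x + \<sigma> * z))\<^sup>2) \<in> borel_measurable (borel \<Otimes>\<^sub>M borel)"
  "\<bar>I x * (r (x + \<sigma> * z))\<^sup>2\<bar> \<le> H\<^sup>2 * I x"
  using r_sq_le[of "x + \<sigma> * z"] by (measurable, auto split: split_indicator split_indicator_asm)

lemma affinity_kernel:
  "(\<lambda>(x, z). r x * r (x + \<sigma> * z)) \<in> borel_measurable (borel \<Otimes>\<^sub>M borel)"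
  "\<bar>r x * r (x + \<sigma> * z)\<bar> \<le> H\<^sup>2 * I x"
  using mult_mono[OF r_le[of x] r_le'[of "x + \<sigma> * z"]] r_nonneg H_nonneg
  by (measurable, simp add: power2_eq_square mult_ac)

lemma mean_stay_eq: "mean_stay \<sigma> = (\<integral>z. stay (\<sigma> * z) \<partial>unif)"
  unfolding mean_stay_def stay_def by (rule unif_Fubini[OF stay_kernel])

lemma mean_affinity_eq: "mean_affinity \<sigma> = (\<integral>z. affinity (\<sigma> * z) \<partial>unif)"
  unfolding mean_affinity_def affinity_def by (rule unif_Fubini[OF affinity_kernel])

lemma stay_measurable [measurable]: "stay \<in> borel_measurable borel"
  unfolding stay_def[abs_def] by measurable

lemma mean_stay_reflect: "(\<integral>z. stay (- (\<sigma> * z)) \<partial>unif) = mean_stay \<sigma>"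
  unfolding mean_stay_eq by (subst integral_unif_reflect[symmetric]) auto

text \<open>Translation turns the reversed move into a move by \<open>- (\<sigma> * z)\<close>, and
  the symmetry of the increment law removes the sign.\<close>

lemma mean_reverse_stay:
  "(\<integral>x. \<integral>z. I x * (r (x + \<sigma> * z))\<^sup>2 \<partial>unif \<partial>lborel) = mean_stay \<sigma>"
  by (subst unif_Fubini[OF reverse_stay_kernel]) (simp add: stay_translate mean_stay_reflect)

lemma integrable_stay: "integrable unif (\<lambda>z. stay (\<sigma> * z))"
  unfolding stay_def by (rule unif_integrable_lborel[OF stay_kernel])

lemma integrable_affinity: "integrable unif (\<lambda>z. affinity (\<sigma> * z))"
  unfolding affinity_def by (rule unif_integrable_lborel[OF affinity_kernel])

lemma integrable_stay_pair: "integrable unif (\<lambda>z. stay (\<sigma> * z) + stay (- (\<sigma> * z)))"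
  using integrable_stay[of \<sigma>] integrable_stay[of "-\<sigma>"] by simp

lemma integral_stay_pair: "(\<integral>z. stay (\<sigma> * z) + stay (- (\<sigma> * z)) \<partial>unif) = 2 * mean_stay \<sigma>"
  using integrable_stay[of \<sigma>] integrable_stay[of "-\<sigma>"]
  by (simp add: mean_stay_reflect flip: mean_stay_eq)

text \<open>By symmetry the pair \<open>stay s + stay (- s)\<close> averages to
  \<open>2 * mean_stay \<sigma>\<close>, so the expansion for pairs suffices. The mean of
  \<open>\<bar>z\<bar>\<close> is 1/2; together with halving the pair this yields the divisor
  4.\<close>

lemma mean_stay_expansion:
  assumes "0 < \<sigma>" "\<sigma> < 1"
  shows "\<bar>mean_stay \<sigma> - (1 - ((h 0)\<^sup>2 + (h 1)\<^sup>2) / 4 * \<sigma>)\<bar> \<le> 2 * L * H * \<sigma>\<^sup>2"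
proof -
  interpret U: prob_space unif
    by (rule prob_space_unif)
  let ?c = "(h 0)\<^sup>2 + (h 1)\<^sup>2"
  let ?u = "\<lambda>z. stay (\<sigma> * z) + stay (- (\<sigma> * z)) - (2 - ?c * \<sigma> * \<bar>z\<bar>)"
  have abs: "integrable unif abs"
    by (rule U.integrable_const_bound[of _ 1]) (use AE_unif_abs_le in auto)
  then have lin: "integrable unif (\<lambda>z. 2 - ?c * \<sigma> * \<bar>z\<bar>)"
    by (intro Bochner_Integration.integrable_diff integrable_mult_right) auto
  have "\<bar>integral\<^sup>L unif ?u\<bar> \<le> 4 * L * H * \<sigma>\<^sup>2"
  proof (rule abs_integral_unif_le)
    fix z :: real
    assume z: "\<bar>z\<bar> \<le> 1"
    then have "\<bar>\<sigma> * z\<bar> \<le> \<sigma> * 1"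
      using assms by (simp add: abs_mult)
    then have *: "\<bar>\<sigma> * z\<bar> < 1" "(\<sigma> * z)\<^sup>2 \<le> \<sigma>\<^sup>2"
      using assms power_mono[of "\<bar>\<sigma> * z\<bar>" \<sigma> 2] by auto
    have "\<bar>?u z\<bar> \<le> 4 * L * H * (\<sigma> * z)\<^sup>2"
      using stay_pair_expansion[OF *(1)] assms by (simp add: abs_mult mult_ac)
    also have "\<dots> \<le> 4 * L * H * \<sigma>\<^sup>2"
      using * L_nonneg H_nonneg by (intro mult_left_mono) auto
    finally show "\<bar>?u z\<bar> \<le> 4 * L * H * \<sigma>\<^sup>2" .
  qed (intro Bochner_Integration.integrable_diff integrable_stay_pair lin)
  also have "integral\<^sup>L unif ?u = 2 * mean_stay \<sigma> - (\<integral>z. 2 - ?c * \<sigma> * \<bar>z\<bar> \<partial>unif)"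
    by (simp only: Bochner_Integration.integral_diff[OF integrable_stay_pair lin] integral_stay_pair)
  also have "(\<integral>z. 2 - ?c * \<sigma> * \<bar>z\<bar> \<partial>unif) = 2 - ?c * \<sigma> / 2"
    by (subst Bochner_Integration.integral_diff) (use abs in \<open>auto simp: integral_unif_abs U.prob_space\<close>)
  finally show ?thesis
    by (simp add: algebra_simps)
qed

text \<open>The defect is quadratic in the shift and stays so after averaging. With
  \<open>\<sigma> = l / d\<close> it is of order \<open>1 / d^2\<close>, too small to change the
  limit of the \<open>d\<close>-th power.\<close>

lemma mean_affinity_defect:
  assumes "0 < \<sigma>"
  shows "\<bar>mean_affinity \<sigma> - mean_stay \<sigma>\<bar> \<le> L\<^sup>2 * \<sigma>\<^sup>2"
proof -
  let ?u = "\<lambda>z. stay (\<sigma> * z) + stay (- (\<sigma> * z)) - 2 * affinity (\<sigma> * z)"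
  have "\<bar>integral\<^sup>L unif ?u\<bar> \<le> L\<^sup>2 * \<sigma>\<^sup>2"
  proof (rule abs_integral_unif_le)
    fix z :: real
    assume z: "\<bar>z\<bar> \<le> 1"
    then have "\<bar>\<sigma> * z\<bar> \<le> \<sigma> * 1"
      using assms by (simp add: abs_mult)
    then have "(\<sigma> * z)\<^sup>2 \<le> \<sigma>\<^sup>2"
      using assms power_mono[of "\<bar>\<sigma> * z\<bar>" \<sigma> 2] by auto
    then show "\<bar>?u z\<bar> \<le> L\<^sup>2 * \<sigma>\<^sup>2"
      using affinity_defect[of "\<sigma> * z"] mult_left_mono[of "(\<sigma> * z)\<^sup>2" "\<sigma>\<^sup>2" "L\<^sup>2"] by auto
  qed (intro Bochner_Integration.integrable_diff integrable_stay_pair integrable_mult_right integrable_affinity)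
  also have "integral\<^sup>L unif ?u = 2 * mean_stay \<sigma> - 2 * mean_affinity \<sigma>"
    by (subst Bochner_Integration.integral_diff[OF integrable_stay_pair])
      (auto simp: integral_stay_pair integrable_affinity mean_affinity_eq)
  finally show ?thesis
    by simp
qed

subsection \<open>The product target\<close>

abbreviation lborels :: "nat \<Rightarrow> (nat \<Rightarrow> real) measure" where
  "lborels d \<equiv> \<Pi>\<^sub>M i\<in>{..<d}. lborel"

abbreviation unifs :: "nat \<Rightarrow> (nat \<Rightarrow> real) measure" where
  "unifs d \<equiv> \<Pi>\<^sub>M i\<in>{..<d}. unif"

definition R :: "nat \<Rightarrow> (nat \<Rightarrow> real) \<Rightarrow> real" where
  "R d x = (\<Prod>i<d. r (x i))"

lemma R_nonneg: "0 \<le> R d x"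
  unfolding R_def by (intro prod_nonneg) (auto simp: r_nonneg)

lemma R_measurable [measurable]: "R d \<in> borel_measurable (lborels d)"
  unfolding R_def[abs_def] by measurable

lemma R_shift_measurable [measurable]:
  "(\<lambda>(x, z). R d (\<lambda>i. x i + \<sigma> * z i)) \<in> borel_measurable (lborels d \<Otimes>\<^sub>M unifs d)"
  unfolding R_def by measurable

lemma prob_space_unifs: "prob_space (unifs d)"
  by (intro prob_space_PiM prob_space_unif)

text \<open>The acceptance probability at \<open>x\<close> multiplied by the target density
  \<open>(R d x)\<^sup>2\<close>, written without the quotient.\<close>

definition overlap :: "nat \<Rightarrow> real \<Rightarrow> (nat \<Rightarrow> real) \<Rightarrow> real" where
  "overlap d \<sigma> x = (\<integral>z. min ((R d x)\<^sup>2) ((R d (\<lambda>i. x i + \<sigma> * z i))\<^sup>2) \<partial>unifs d)"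

lemma overlap_measurable [measurable]: "overlap d \<sigma> \<in> borel_measurable (lborels d)"
proof -
  interpret U: prob_space "unifs d"
    by (rule prob_space_unifs)
  show ?thesis
    unfolding overlap_def[abs_def] by measurable
qed

lemma overlap_integrand_integrable:
  assumes "x \<in> space (lborels d)"
  shows "integrable (unifs d) (\<lambda>z. min ((R d x)\<^sup>2) ((R d (\<lambda>i. x i + \<sigma> * z i))\<^sup>2))"
proof -
  interpret U: prob_space "unifs d"
    by (rule prob_space_unifs)
  have [measurable]: "(\<lambda>z. R d (\<lambda>i. x i + \<sigma> * z i)) \<in> borel_measurable (unifs d)"
    using measurable_compose[OF measurable_Pair1'[OF assms] R_shift_measurable] by simp
  show ?thesis
    by (rule U.integrable_const_bound[of _ "(R d x)\<^sup>2"]) auto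
qed

lemma overlap_le: "overlap d \<sigma> x \<le> (R d x)\<^sup>2" if "x \<in> space (lborels d)"
proof -
  interpret U: prob_space "unifs d"
    by (rule prob_space_unifs)
  show ?thesis
    unfolding overlap_def
    by (rule U.integral_le_const[OF overlap_integrand_integrable[OF that]]) auto
qed

lemma overlap_nonneg: "0 \<le> overlap d \<sigma> x"
  unfolding overlap_def by (intro integral_nonneg_AE AE_I2) auto

lemma integrable_R_sq: "integrable (lborels d) (\<lambda>x. (R d x)\<^sup>2)"
proof -
  interpret product_sigma_finite "\<lambda>i::nat. lborel :: real measure"
    by unfold_locales
  show ?thesis
    unfolding R_def prod_power_distrib
    by (intro product_integrable_prod integrable_r_sq) auto
qed

lemma integrable_overlap: "integrable (lborels d) (overlap d \<sigma>)"
  by (rule Bochner_Integration.integrable_bound[OF integrable_R_sq])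
    (use overlap_le overlap_nonneg in \<open>auto intro!: AE_I2\<close>)

text \<open>The minimum of the two densities is at most their geometric mean, and the latter, unlike
  the minimum, is a product over the coordinates.\<close>

lemma overlap_upper: "integral\<^sup>L (lborels d) (overlap d \<sigma>) \<le> mean_affinity \<sigma> ^ d"
proof -
  note aff = prod_integral_iterated[OF affinity_kernel, where d = d]
  have "integral\<^sup>L (lborels d) (overlap d \<sigma>)
      \<le> (\<integral>x. \<integral>z. (\<Prod>i<d. r (x i) * r (x i + \<sigma> * z i)) \<partial>unifs d \<partial>lborels d)"
  proof (rule integral_mono[OF integrable_overlap aff(2)])
    fix x assume x: "x \<in> space (lborels d)"
    show "overlap d \<sigma> x \<le> (\<integral>z. (\<Prod>i<d. r (x i) * r (x i + \<sigma> * z i)) \<partial>unifs d)"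
      unfolding overlap_def
    proof (rule integral_mono[OF overlap_integrand_integrable[OF x] aff(3)])
      fix z
      show "min ((R d x)\<^sup>2) ((R d (\<lambda>i. x i + \<sigma> * z i))\<^sup>2) \<le> (\<Prod>i<d. r (x i) * r (x i + \<sigma> * z i))"
        using min_sq_le_mult[OF R_nonneg R_nonneg] by (simp add: R_def prod.distrib)
    qed
  qed
  then show ?thesis
    by (simp add: aff(1) mean_affinity_def)
qed

text \<open>Supplies the alternatives that \<open>min_sq_lower_bound\<close> demands of its
  indicators: a single coordinate outside the interval annihilates both products.\<close>

lemma prod_indicator_cases:
  fixes x :: "nat \<Rightarrow> real"
  shows "(\<Prod>i<d. I (x i)) = 0 \<and> R d x = 0 \<or> (\<Prod>i<d. I (x i)) = 1"
proof (cases "\<forall>i<d. x i \<in> {0<..<1}")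
  case True
  then have "(\<Prod>i<d. I (x i)) = 1"
    by (intro prod.neutral) auto
  then show ?thesis ..
next
  case False
  then obtain i where "i < d" "I (x i) = 0"
    by auto
  then have "(\<Prod>i<d. I (x i)) = 0" "R d x = 0"
    by (auto simp: R_def r_def intro!: prod_zero bexI[of _ i])
  then show ?thesis
    by simp
qed

text \<open>Integrates \<open>min_sq_lower_bound\<close> with \<open>u\<close>, \<open>v\<close> the
  values of \<open>R\<close> before and after the move. Each term on the left factorises; the
  forward and the reverse staying terms have equal integrals, whence the factor 2.\<close>

lemma overlap_lower:
  assumes "1 < t"
  shows "2 * t * mean_affinity \<sigma> ^ d - 2 * mean_stay \<sigma> ^ d
    \<le> (t\<^sup>2 - 1) * integral\<^sup>L (lborels d) (overlap d \<sigma>)"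
proof -
  note aff = prod_integral_iterated[OF affinity_kernel, where d = d]
  note fwd = prod_integral_iterated[OF stay_kernel, where d = d]
  note rev = prod_integral_iterated[OF reverse_stay_kernel, where d = d]
  let ?A = "\<lambda>x z. \<Prod>i<d. r (x i) * r (x i + \<sigma> * z i)"
  let ?F = "\<lambda>x z. \<Prod>i<d. (r (x i))\<^sup>2 * I (x i + \<sigma> * z i)"
  let ?B = "\<lambda>x z. \<Prod>i<d. I (x i) * (r (x i + \<sigma> * z i))\<^sup>2"
  let ?m = "\<lambda>x z. min ((R d x)\<^sup>2) ((R d (\<lambda>i. x i + \<sigma> * z i))\<^sup>2)"
  let ?g = "\<lambda>x. 2 * t * (\<integral>z. ?A x z \<partial>unifs d) - (\<integral>z. ?F x z \<partial>unifs d) - (\<integral>z. ?B x z \<partial>unifs d)"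
  have pointwise: "2 * t * ?A x z - ?F x z - ?B x z \<le> (t\<^sup>2 - 1) * ?m x z" for x z
    using min_sq_lower_bound[OF R_nonneg R_nonneg assms prod_indicator_cases[of x d]
        prod_indicator_cases[of "\<lambda>i. x i + \<sigma> * z i" d]]
    by (simp add: R_def prod.distrib flip: prod_power_distrib)
  have "integral\<^sup>L (lborels d) ?g \<le> (\<integral>x. (t\<^sup>2 - 1) * overlap d \<sigma> x \<partial>lborels d)"
  proof (rule integral_mono)
    show "integrable (lborels d) ?g"
      by (intro Bochner_Integration.integrable_diff integrable_mult_right aff(2) fwd(2) rev(2))
    show "integrable (lborels d) (\<lambda>x. (t\<^sup>2 - 1) * overlap d \<sigma> x)"
      by (intro integrable_mult_right integrable_overlap)
    fix x assume x: "x \<in> space (lborels d)"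
    have "?g x = (\<integral>z. 2 * t * ?A x z - ?F x z - ?B x z \<partial>unifs d)"
      using aff(3) fwd(3) rev(3) by simp
    also have "\<dots> \<le> (\<integral>z. (t\<^sup>2 - 1) * ?m x z \<partial>unifs d)"
      by (intro integral_mono Bochner_Integration.integrable_diff integrable_mult_right aff(3) fwd(3) rev(3)
          overlap_integrand_integrable x pointwise)
    also have "\<dots> = (t\<^sup>2 - 1) * overlap d \<sigma> x"
      by (simp add: overlap_def)
    finally show "?g x \<le> (t\<^sup>2 - 1) * overlap d \<sigma> x" .
  qed
  also have "integral\<^sup>L (lborels d) ?g = 2 * t * mean_affinity \<sigma> ^ d - mean_stay \<sigma> ^ d - mean_stay \<sigma> ^ d"
    using aff(2) fwd(2) rev(2)
    by (simp add: aff(1)[folded mean_affinity_def] fwd(1)[folded mean_stay_def]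
        rev(1)[unfolded mean_reverse_stay])
  finally show ?thesis
    by simp
qed

lemma mean_stay_bounds: "0 \<le> mean_stay \<sigma>" "mean_stay \<sigma> \<le> 1"
proof -
  interpret U: prob_space unif
    by (rule prob_space_unif)
  show "0 \<le> mean_stay \<sigma>" "mean_stay \<sigma> \<le> 1"
    unfolding mean_stay_eq
    by (intro U.integral_ge_const U.integral_le_const integrable_stay AE_I2 stay_nonneg stay_le_1)+
qed

lemma mean_affinity_bounds: "0 \<le> mean_affinity \<sigma>" "mean_affinity \<sigma> \<le> 1"
proof -
  interpret U: prob_space unif
    by (rule prob_space_unif)
  show "0 \<le> mean_affinity \<sigma>" "mean_affinity \<sigma> \<le> 1"
    unfolding mean_affinity_eq
    by (intro U.integral_ge_const U.integral_le_const integrable_affinity AE_I2 affinity_nonneg affinity_le_1)+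
qed

lemma overlap_tendsto:
  assumes "0 < l"
  shows "(\<lambda>d. integral\<^sup>L (lborels d) (overlap d (l / real d)))
    \<longlonglongrightarrow> exp (- (((h 0)\<^sup>2 + (h 1)\<^sup>2) / 4 * l))"
proof -
  let ?c = "((h 0)\<^sup>2 + (h 1)\<^sup>2) / 4"
  \<comment> \<open>Ensures a step size \<open>l / d\<close> below 1, as
    \<open>mean_stay_expansion\<close> requires.\<close>
  have large: "eventually (\<lambda>d. l < real d) sequentially"
    using eventually_gt_at_top[of "nat \<lceil>l\<rceil>"] by eventually_elim linarith
  have "eventually (\<lambda>d. \<bar>mean_stay (l / d) - (1 - ?c * l / d)\<bar> \<le> (2 * L * H * l\<^sup>2) / (real d)\<^sup>2) sequentially"
    using large
  proof eventually_elim
    case (elim d)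
    then show ?case
      using mean_stay_expansion[of "l / d"] \<open>0 < l\<close> by (simp add: power_divide)
  qed
  then have p: "(\<lambda>d. mean_stay (l / d) ^ d) \<longlonglongrightarrow> exp (- (?c * l))"
    by (rule power_tendsto_exp) (use mean_stay_bounds \<open>0 < l\<close> in \<open>auto intro!: always_eventually\<close>)
  have "eventually (\<lambda>d. \<bar>mean_affinity (l / d) - (1 - ?c * l / d)\<bar>
      \<le> (2 * L * H * l\<^sup>2 + L\<^sup>2 * l\<^sup>2) / (real d)\<^sup>2) sequentially"
    using large
  proof eventually_elim
    case (elim d)
    then have "\<bar>mean_stay (l / d) - (1 - ?c * l / d)\<bar> \<le> 2 * L * H * l\<^sup>2 / (real d)\<^sup>2"
      "\<bar>mean_affinity (l / d) - mean_stay (l / d)\<bar> \<le> L\<^sup>2 * l\<^sup>2 / (real d)\<^sup>2"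
      using mean_stay_expansion[of "l / d"] mean_affinity_defect[of "l / d"] \<open>0 < l\<close>
      by (simp_all add: power_divide)
    then show ?case
      unfolding add_divide_distrib by linarith
  qed
  then have q: "(\<lambda>d. mean_affinity (l / d) ^ d) \<longlonglongrightarrow> exp (- (?c * l))"
    by (rule power_tendsto_exp) (use mean_affinity_bounds \<open>0 < l\<close> in \<open>auto intro!: always_eventually\<close>)
  show ?thesis
    by (rule tendsto_of_parametric_sandwich[OF p q])
      (use overlap_upper overlap_lower in \<open>auto intro!: always_eventually\<close>)
qed

text \<open>Where the target vanishes the acceptance ratio has the junk value \<open>0\<close>, as does the overlap.\<close>

lemma integral_acceptance_prob:
  assumes marginal: "\<And>x. marginal_density g x = (r x)\<^sup>2"
  shows "(\<integral>x. acceptance_prob g d \<sigma> x \<partial>target_measure g d) = integral\<^sup>L (lborels d) (overlap d \<sigma>)"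
proof -
  interpret U: prob_space "unifs d"
    by (rule prob_space_unifs)
  have target: "target_density g d x = (R d x)\<^sup>2" for x
    by (simp add: target_density_def marginal R_def prod_power_distrib)
  have acc: "acceptance_prob g d \<sigma>
      = (\<lambda>x. \<integral>z. min 1 ((R d (\<lambda>i. x i + \<sigma> * z i))\<^sup>2 / (R d x)\<^sup>2) \<partial>unifs d)"
    by (simp add: acceptance_prob_def[abs_def] target increment_measure_def)
  have [measurable]: "acceptance_prob g d \<sigma> \<in> borel_measurable (lborels d)"
    unfolding acc by measurable
  have "(\<integral>x. acceptance_prob g d \<sigma> x \<partial>target_measure g d)
      = (\<integral>x. (R d x)\<^sup>2 *\<^sub>R acceptance_prob g d \<sigma> x \<partial>lborels d)"
    unfolding target_measure_def target by (rule integral_density) auto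
  also have "\<dots> = integral\<^sup>L (lborels d) (overlap d \<sigma>)"
  proof (rule Bochner_Integration.integral_cong)
    fix x
    have "(R d x)\<^sup>2 * min 1 (v / (R d x)\<^sup>2) = min ((R d x)\<^sup>2) v" if "0 \<le> v" for v
      using that by (cases "R d x = 0") (auto simp: min_mult_distrib_left)
    then show "(R d x)\<^sup>2 *\<^sub>R acceptance_prob g d \<sigma> x = overlap d \<sigma> x"
      by (simp add: acc overlap_def flip: integral_mult_right_zero)
  qed simp
  finally show ?thesis .
qed

end

section \<open>Maximising the speed, and the numerical value\<close>

lemma speed_arg_max:
  assumes "0 < fstar g"
  shows "is_arg_max (speed g) (\<lambda>l. l > 0) (4 / fstar g)"
proof -
  let ?b = "fstar g / 4"
  \<comment> \<open>Taking the root reduces the claim to maximising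
    \<open>l * exp (- (?b * l))\<close>. This follows from \<open>y \<le> exp (y - 1)\<close> at
    \<open>y = ?b * l\<close>, with equality at \<open>y = 1\<close>, that is
    \<open>l = 4 / fstar g\<close>.\<close>
  have speed: "speed g l = (l * exp (- (?b * l)))\<^sup>2 / 3" for l
    by (simp add: speed_def power_mult_distrib flip: exp_double)
  have "speed g l \<le> speed g (4 / fstar g)" if "0 < l" for l
  proof -
    have "?b * l \<le> exp (?b * l - 1)"
      using exp_ge_add_one_self[of "?b * l - 1"] by simp
    then have "?b * l * exp (- (?b * l)) \<le> exp (?b * l - 1) * exp (- (?b * l))"
      by (rule mult_right_mono) simp
    also have "\<dots> = exp (- 1)"
      by (simp flip: exp_add)
    finally have "l * exp (- (?b * l)) \<le> 4 / fstar g * exp (- 1)"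
      using assms by (simp add: field_simps)
    then have "(l * exp (- (?b * l)))\<^sup>2 \<le> (4 / fstar g * exp (- 1))\<^sup>2"
      using that by (intro power_mono) auto
    then show ?thesis
      using assms by (simp add: speed)
  qed
  then show ?thesis
    using assms by (force simp: is_arg_max_def)
qed

lemma exp_minus_2_approx: "\<bar>exp (-2) - 0.1353 :: real\<bar> < 0.00005"
proof -
  let ?e = "exp 1 :: real"
  have e: "2.7182 < ?e" "?e < 2.7183"
    using e_approx_32 unfolding abs_le_iff by simp_all
  have "(2.7182::real)\<^sup>2 < ?e\<^sup>2" "?e\<^sup>2 < (2.7183::real)\<^sup>2"
    using e by (auto intro!: power_strict_mono)
  moreover have "exp (-2) = 1 / ?e\<^sup>2"
    by (simp add: exp_minus inverse_eq_divide flip: exp_double)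
  moreover have "1 / (2.7183::real)\<^sup>2 < 1 / ?e\<^sup>2" "1 / ?e\<^sup>2 < 1 / (2.7182::real)\<^sup>2"
    using calculation by (auto intro!: divide_strict_left_mono)
  ultimately show ?thesis
    by (simp add: power2_eq_square abs_less_iff)
qed

section \<open>From the log-density \<open>g\<close> to the root density, and the conclusion\<close>

theorem corollary2p2:
  fixes g g' :: "real \<Rightarrow> real" and l :: real
  assumes g_deriv: "\<And>y. y \<in> {0..1} \<Longrightarrow> (g has_real_derivative g' y) (at y within {0..1})"
    and g'_diff: "g' differentiable_on {0..1}"
    and g'_bdd: "bdd_above ((\<lambda>y. \<bar>g' y\<bar>) ` {0..1})"
    and l_pos: "l > 0"
  shows
    "((\<lambda>x. (marginal_density g x + marginal_density g (1 - x)) / 2) \<longlongrightarrow> fstar g) (at_right 0)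
     \<and> (\<lambda>d. \<integral>x. acceptance_prob g d (l / real d) x \<partial>target_measure g d)
          \<longlonglongrightarrow> limit_acceptance g l
     \<and> is_arg_max (speed g) (\<lambda>l. l > 0) (4 / fstar g)
     \<and> limit_acceptance g (4 / fstar g) = exp (-2)
     \<and> \<bar>exp (-2) - 0.1353 :: real\<bar> < 0.00005"
proof -
  have cont: "continuous_on {0..1} g"
    using g_deriv by (meson DERIV_continuous continuous_on_eq_continuous_within)
  obtain K where K: "\<And>y. y \<in> {0..1} \<Longrightarrow> \<bar>g' y\<bar> \<le> K"
    using g'_bdd unfolding bdd_above_def by blast
  have "bounded (g ` {0..1})"
    by (intro compact_imp_bounded compact_continuous_image cont) auto
  then obtain G where G: "\<And>y. y \<in> {0..1} \<Longrightarrow> \<bar>g y\<bar> \<le> G"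
    unfolding bounded_iff real_norm_def by blast
  define Z where "Z = (\<integral>y. unnormalised_density g y \<partial>lborel)"
  have "continuous_on {0<..<1} (\<lambda>x. exp (g x))"
    by (intro continuous_intros continuous_on_subset[OF cont]) auto
  then have "(\<lambda>x. indicator {0<..<1} x *\<^sub>R exp (g x)) \<in> borel_measurable borel"
    by (intro borel_measurable_continuous_on_indicator) auto
  then have [measurable]: "unnormalised_density g \<in> borel_measurable borel"
    by (simp add: unnormalised_density_def[abs_def] mult.commute)
  have bnd: "integrable lborel (\<lambda>x. k * indicator {0<..<1::real} x)" for k :: real
    by (intro integrable_mult_right integrable_real_indicator) auto
  have int: "integrable lborel (unnormalised_density g)"
    by (rule Bochner_Integration.integrable_bound[OF bnd[of "exp G"]])
      (use G in \<open>auto intro!: AE_I2 simp: unnormalised_density_def abs_le_iff split: split_indicator\<close>)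
  \<comment> \<open>The normalising constant is positive: \<open>exp (- G)\<close> bounds the
    unnormalised density from below on an interval of length 1.\<close>
  have "(\<integral>x. exp (- G) * indicator {0<..<1::real} x \<partial>lborel) \<le> Z"
    unfolding Z_def
    by (intro integral_mono bnd int)
      (use G in \<open>auto simp: unnormalised_density_def abs_le_iff minus_le_iff split: split_indicator\<close>)
  then have Z: "0 < Z"
    by (simp add: less_le_trans[OF exp_gt_zero])
  \<comment> \<open>The root of the density without the indicator, hence Lipschitz up to and
    including the endpoints.\<close>
  define h where "h x = exp (g x / 2) / sqrt Z" for x
  have h_sq: "(h x)\<^sup>2 = exp (g x) / Z" for x
    using Z by (simp add: h_def power_divide flip: exp_double)
  have marginal: "marginal_density g x = (h x * indicator {0<..<1} x)\<^sup>2" for x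
    by (simp add: marginal_density_def h_sq power_mult_distrib unnormalised_density_def[of g x]
        split: split_indicator flip: Z_def)
  \<comment> \<open>Bounds the derivative \<open>exp (g u / 2) * (g' u / 2) / sqrt Z\<close> of
    \<open>h\<close>, using the bounds \<open>G\<close> for \<open>g\<close> and \<open>K\<close>
    for \<open>g'\<close>.\<close>
  define L where "L = exp (G / 2) * (K / 2) / sqrt Z"
  interpret root_density h L
  proof
    fix x y :: real
    assume xy: "x \<in> {0..1}" "y \<in> {0..1}"
    have "norm (h x - h y) \<le> L * norm (x - y)"
    proof (rule field_differentiable_bound[of "{0..1}" h "\<lambda>x. exp (g x / 2) * (g' x / 2) / sqrt Z"])
      fix u :: real assume u: "u \<in> {0..1}"
      show "(h has_field_derivative exp (g u / 2) * (g' u / 2) / sqrt Z) (at u within {0..1})"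
        unfolding h_def[abs_def] by (intro DERIV_cdivide) (auto intro!: derivative_eq_intros g_deriv u)
      show "norm (exp (g u / 2) * (g' u / 2) / sqrt Z) \<le> L"
        unfolding L_def using Z K[OF u] G[OF u]
        by (auto simp: abs_mult intro!: divide_right_mono mult_mono)
    qed (use xy in auto)
    then show "\<bar>h x - h y\<bar> \<le> L * \<bar>x - y\<bar>"
      by simp
  next
    show "0 \<le> h x" for x
      using Z by (simp add: h_def)
    have "(\<integral>x. marginal_density g x \<partial>lborel) = 1"
      using Z by (simp add: marginal_density_def[abs_def] flip: Z_def)
    then show "(\<integral>x. (h x * indicator {0<..<1} x)\<^sup>2 \<partial>lborel) = 1"
      by (simp add: marginal)
  qed
  have marginal_r: "marginal_density g x = (r x)\<^sup>2" for x
    by (simp add: marginal r_def)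
  have h_cont: "continuous_on {0..1} h"
    unfolding h_def[abs_def] using Z by (intro continuous_intros cont) auto
  have "((\<lambda>x. ((h x)\<^sup>2 + (h (1 - x))\<^sup>2) / 2) \<longlongrightarrow> ((h 0)\<^sup>2 + (h (1 - 0))\<^sup>2) / 2) (at 0 within {0..1})"
  proof -
    have "continuous_on {0..1} (\<lambda>x. ((h x)\<^sup>2 + (h (1 - x))\<^sup>2) / 2)"
      by (intro continuous_intros h_cont continuous_on_compose2[OF h_cont]) auto
    then show ?thesis
      unfolding continuous_on_def by (rule bspec) simp
  qed
  then have "((\<lambda>x. ((h x)\<^sup>2 + (h (1 - x))\<^sup>2) / 2) \<longlongrightarrow> ((h 0)\<^sup>2 + (h 1)\<^sup>2) / 2) (at_right 0)"
    by (simp add: at_within_Icc_at_right)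
  \<comment> \<open>The marginal density vanishes at the endpoints, so it is identified with the
    square of \<open>h\<close> only inside the interval, which is all that the one-sided limit
    sees.\<close>
  moreover have "eventually (\<lambda>x. x \<in> {0<..<1}) (at_right (0::real))"
    by (rule eventually_at_right_real) simp
  then have "eventually (\<lambda>x. ((h x)\<^sup>2 + (h (1 - x))\<^sup>2) / 2
      = (marginal_density g x + marginal_density g (1 - x)) / 2) (at_right 0)"
    by eventually_elim (simp add: marginal)
  ultimately have lim: "((\<lambda>x. (marginal_density g x + marginal_density g (1 - x)) / 2)
      \<longlongrightarrow> ((h 0)\<^sup>2 + (h 1)\<^sup>2) / 2) (at_right 0)"
    by (rule Lim_transform_eventually)
  then have fstar: "fstar g = ((h 0)\<^sup>2 + (h 1)\<^sup>2) / 2"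
    unfolding fstar_def by (intro tendsto_Lim) auto
  have fstar_pos: "0 < fstar g"
    using Z by (simp add: fstar h_sq add_pos_pos)
  \<comment> \<open>The slope in the expansion of \<open>mean_stay\<close> is exactly
    \<open>fstar g / 2\<close>.\<close>
  have "limit_acceptance g l = exp (- (((h 0)\<^sup>2 + (h 1)\<^sup>2) / 4 * l))"
    by (simp add: limit_acceptance_def fstar)
  then have "(\<lambda>d. \<integral>x. acceptance_prob g d (l / real d) x \<partial>target_measure g d)
      \<longlonglongrightarrow> limit_acceptance g l"
    using overlap_tendsto[OF l_pos] by (simp add: integral_acceptance_prob[OF marginal_r])
  moreover have "limit_acceptance g (4 / fstar g) = exp (- 2)"
    using fstar_pos by (simp add: limit_acceptance_def)
  ultimately show ?thesis
    using lim speed_arg_max[OF fstar_pos] exp_minus_2_approx by (simp add: fstar)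
qed

end
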